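(* Let $H$ be a Hilbert space and $C$ a nonempty closed convex subset of $H$. Let $T:C\to CC(C)$ be a *-$b$-enriched nonexpansive mapping (for some $b\in[0,\infty)$) such that there exists $p\in F(T)$ with $Tp=\{p\}$. Then there exists $\theta\in(0,1)$ such that for any $x_0\in C$, the Krasnoselskii iteration $\{x_n\}_{n=0}^\infty$ given by $$x_{n+1}=(1-\theta)x_n+\theta y_n,\qquad n\ge 0,\quad y_n\in P_T x_n,$$ converges weakly to a fixed point of $T$.
   Context: $CC(C)$ denotes the family of nonempty closed and convex subsets of $C$. For a point $x$ and a nonempty set $A$, $d(x,A)=\inf_{a\in A}\|x-a\|$, and $d(x,y)=\|x-y\|$. A multivalued mapping $T$ on $C$ is called *-$b$-enriched nonexpansive, where $b\in[0,\infty)$, if for all $x,y\in C$ and every $u_x\in Tx$ with $d(x,u_x)=d(x,Tx)$ there exists $u_y\in Ty$ with $d(y,u_y)=d(y,Ty)$ such that $\|b(x-y)+(u_x-u_y)\|\le (b+1)\|x-y\|$. The best approximation operator of $T$ is $P_Tx=\{u\in Tx: d(x,u)=d(x,Tx)\}$, $x\in C$. $F(T)=\{x\in C:x\in Tx\}$ is the set of fixed points of $T$. *)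

theory Defs
  imports "HOL-Analysis.Analysis"
begin

text \<open>A multivalued mapping on \<open>C\<close> is a function \<open>T :: 'a \<Rightarrow> 'a set\<close> of which only the
  values at points of \<open>C\<close> are used.  The values considered below are nonempty, so
  \<open>infdist x A\<close> is the infimum of \<open>\<parallel>x - a\<parallel>\<close> over \<open>a \<in> A\<close>; its convention for the
  empty set plays no role.\<close>

definition CC :: "'a::real_normed_vector set \<Rightarrow> 'a set set" where
  "CC C = {A. A \<subseteq> C \<and> A \<noteq> {} \<and> closed A \<and> convex A}"

definition best_approx :: "('a::real_normed_vector \<Rightarrow> 'a set) \<Rightarrow> 'a \<Rightarrow> 'a set" where
  "best_approx T x = {u \<in> T x. dist x u = infdist x (T x)}"

definition fixed_points :: "'a set \<Rightarrow> ('a \<Rightarrow> 'a set) \<Rightarrow> 'a set" where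
  "fixed_points C T = {x \<in> C. x \<in> T x}"

definition star_enriched_nonexpansive ::
    "real \<Rightarrow> 'a::real_normed_vector set \<Rightarrow> ('a \<Rightarrow> 'a set) \<Rightarrow> bool" where
  "star_enriched_nonexpansive b C T \<longleftrightarrow>
     b \<ge> 0 \<and>
     (\<forall>x\<in>C. \<forall>y\<in>C. \<forall>u\<in>T x. dist x u = infdist x (T x) \<longrightarrow>
        (\<exists>v\<in>T y. dist y v = infdist y (T y) \<and>
           norm (b *\<^sub>R (x - y) + (u - v)) \<le> (b + 1) * norm (x - y)))"

definition weakly_converges :: "(nat \<Rightarrow> 'a::real_normed_vector) \<Rightarrow> 'a \<Rightarrow> bool" where
  "weakly_converges X l \<longleftrightarrow>
     (\<forall>f :: 'a \<Rightarrow> real. bounded_linear f \<longrightarrow> (\<lambda>n. f (X n)) \<longlonglongrightarrow> f l)"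

end

theory Submission
  imports Defs
begin

text \<open>Nearest points in closed convex subsets of a Hilbert space exist and are unique, so \<open>P\<^sub>T\<close> is
  a genuine function on \<open>C\<close>. The enriched condition then says precisely that the average
  \<open>S x = (b x + P\<^sub>T x) / (b + 1)\<close> is nonexpansive on \<open>C\<close>
  (\<open>averaged_best_map_nonexpansive\<close>), and \<open>S\<close> has the same fixed points as \<open>T\<close>, because
  \<open>x \<in> T x\<close> holds exactly when \<open>x\<close> is its own nearest point. A step of length \<open>\<theta>\<close> towards
  \<open>P\<^sub>T x\<close> is a step of length \<open>\<theta> (b + 1)\<close> towards \<open>S x\<close>; with \<open>\<theta> = 1 / (2 (b + 1))\<close> the
  given iteration is the classical Krasnoselskii iteration of \<open>S\<close> with parameter \<open>1/2\<close>.

  The classical argument goes as follows. The iterates never move away from a fixed point of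
  \<open>S\<close>, and \<open>\<parallel>x\<^sub>n - S x\<^sub>n\<parallel>\<close> tends to 0, since its square is bounded by a multiple of the decrease
  of the squared distance to a fixed point. Every weak cluster point is then a fixed point, and Opial's
  argument shows that there is only one.

  Here the part of weak cluster points is taken by asymptotic centres of subsequences: the
  points \<open>q\<close> that minimise the asymptotic radius \<open>limsup \<parallel>x\<^sub>n - q\<parallel>\<close>. By the
  parallelogram law and completeness such a minimiser exists and is unique. Three facts make it a substitute for a weak cluster point:

  \<^item> it lies in every closed convex set that contains the sequence
    (\<open>asymp_center_in_closed_convex\<close>);
  \<^item> it is a fixed point of \<open>S\<close> as soon as \<open>\<parallel>x\<^sub>n - S x\<^sub>n\<parallel>\<close> tends to 0, because then \<open>S q\<close> has at
    most the asymptotic radius of \<open>q\<close>;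
  \<^item> if \<open>q\<close> is the centre of every subsequence, then the sequence converges weakly to \<open>q\<close>:
    otherwise a subsequence stays in a closed half-space that avoids \<open>q\<close>, contradicting the
    first fact (\<open>functional_tendsto_if_center\<close>).

  In place of subsequences the development uses filters finer than the given one, which avoids
  all reindexing.\<close>

section \<open>Asymptotic radius and asymptotic centres\<close>

text \<open>For a bounded family this is the limes superior of \<open>\<parallel>X i - z\<parallel>\<close> along \<open>F\<close>. The infimum
  of the eventual bounds stays within the type of real numbers.\<close>

definition asymp_radius :: "'i filter \<Rightarrow> ('i \<Rightarrow> 'a::real_normed_vector) \<Rightarrow> 'a \<Rightarrow> real" where
  "asymp_radius F X z = Inf {r. \<forall>\<^sub>F i in F. norm (X i - z) \<le> r}"

definition asymp_center :: "'i filter \<Rightarrow> ('i \<Rightarrow> 'a::real_normed_vector) \<Rightarrow> 'a \<Rightarrow> bool" where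
  "asymp_center F X q \<longleftrightarrow> (\<forall>z. asymp_radius F X q \<le> asymp_radius F X z)"

lemma eventual_bound_nonneg:
  assumes "F \<noteq> bot" "\<forall>\<^sub>F i in F. norm (X i - z) \<le> r"
  shows "0 \<le> r"
proof -
  obtain i where "norm (X i - z) \<le> r"
    using eventually_happens'[OF assms] by blast
  then show ?thesis
    using norm_ge_zero[of "X i - z"] by linarith
qed

lemma asymp_radius_le:
  assumes "F \<noteq> bot" "\<forall>\<^sub>F i in F. norm (X i - z) \<le> r"
  shows "asymp_radius F X z \<le> r"
  unfolding asymp_radius_def
proof (rule cInf_lower)
  show "bdd_below {r. \<forall>\<^sub>F i in F. norm (X i - z) \<le> r}"
    by (rule bdd_belowI[of _ 0]) (simp add: eventual_bound_nonneg[OF assms(1)])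
qed (use assms in simp)

lemma eventual_bound_ex:
  assumes "Bfun X F"
  shows "\<exists>r. \<forall>\<^sub>F i in F. norm (X i - z) \<le> r"
proof -
  obtain K where "\<forall>\<^sub>F i in F. norm (X i) \<le> K"
    using assms by (auto simp: Bfun_def)
  then have "\<forall>\<^sub>F i in F. norm (X i - z) \<le> K + norm z"
    by (rule eventually_mono) (rule norm_triangle_le_diff, simp)
  then show ?thesis ..
qed

lemma asymp_radius_nonneg:
  assumes "F \<noteq> bot" "Bfun X F"
  shows "0 \<le> asymp_radius F X z"
  unfolding asymp_radius_def
proof (rule cInf_greatest)
  show "{r. \<forall>\<^sub>F i in F. norm (X i - z) \<le> r} \<noteq> {}"
    using eventual_bound_ex[OF assms(2)] by simp
qed (simp add: eventual_bound_nonneg[OF assms(1)])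

lemma eventually_le_asymp_radius_add:
  assumes "Bfun X F" "0 < e"
  shows "\<forall>\<^sub>F i in F. norm (X i - z) \<le> asymp_radius F X z + e"
proof -
  let ?R = "{r. \<forall>\<^sub>F i in F. norm (X i - z) \<le> r}"
  have "?R \<noteq> {}"
    using eventual_bound_ex[OF assms(1)] by simp
  moreover have "Inf ?R < asymp_radius F X z + e"
    using assms(2) by (simp add: asymp_radius_def)
  ultimately have "\<exists>r\<in>?R. r < asymp_radius F X z + e"
    by (rule cInf_lessD)
  then obtain r where r: "\<forall>\<^sub>F i in F. norm (X i - z) \<le> r" "r < asymp_radius F X z + e"
    by auto
  show ?thesis
    using r(1) by (rule eventually_mono) (use r(2) in simp)
qed

lemma asymp_radius_le_add:
  assumes "F \<noteq> bot" "Bfun X F"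
    and le: "\<And>e. 0 < e \<Longrightarrow> \<forall>\<^sub>F i in F. norm (X i - z) \<le> norm (X i - w) + c + e"
  shows "asymp_radius F X z \<le> asymp_radius F X w + c"
proof (rule field_le_epsilon)
  fix e :: real assume "0 < e"
  then have "\<forall>\<^sub>F i in F. norm (X i - z) \<le> norm (X i - w) + c + e/2"
    "\<forall>\<^sub>F i in F. norm (X i - w) \<le> asymp_radius F X w + e/2"
    using le[of "e/2"] eventually_le_asymp_radius_add[OF assms(2), of "e/2"]
    by (simp_all only: half_gt_zero)
  then have "\<forall>\<^sub>F i in F. norm (X i - z) \<le> asymp_radius F X w + c + e"
    by eventually_elim (simp add: field_simps)
  then show "asymp_radius F X z \<le> asymp_radius F X w + c + e"
    by (rule asymp_radius_le[OF assms(1)])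
qed

lemma asymp_radius_lipschitz:
  assumes "F \<noteq> bot" "Bfun X F"
  shows "asymp_radius F X z \<le> asymp_radius F X w + dist z w"
proof (rule asymp_radius_le_add[OF assms])
  fix e :: real assume "0 < e"
  then have "norm (X i - z) \<le> norm (X i - w) + dist z w + e" for i
    using norm_triangle_ineq[of "X i - w" "w - z"] by (simp add: dist_norm norm_minus_commute)
  then show "\<forall>\<^sub>F i in F. norm (X i - z) \<le> norm (X i - w) + dist z w + e"
    by simp
qed

lemma continuous_on_asymp_radius:
  assumes "F \<noteq> bot" "Bfun X F"
  shows "continuous_on UNIV (asymp_radius F X)"
proof -
  have "1-lipschitz_on UNIV (asymp_radius F X)"
  proof (rule lipschitz_onI)
    show "dist (asymp_radius F X z) (asymp_radius F X w) \<le> 1 * dist z w" for z w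
      using asymp_radius_lipschitz[OF assms, of z w] asymp_radius_lipschitz[OF assms, of w z]
      by (simp add: dist_real_def abs_le_iff dist_commute)
  qed simp
  then show ?thesis
    by (rule lipschitz_on_continuous_on)
qed

lemma asymp_radius_eq_limit:
  assumes "F \<noteq> bot" "Bfun X F" "((\<lambda>i. norm (X i - z)) \<longlongrightarrow> l) F"
  shows "asymp_radius F X z = l"
proof (rule antisym)
  show "asymp_radius F X z \<le> l"
  proof (rule field_le_epsilon)
    fix e :: real assume "0 < e"
    then have "\<forall>\<^sub>F i in F. norm (X i - z) < l + e"
      using order_tendstoD(2)[OF assms(3)] by simp
    then have "\<forall>\<^sub>F i in F. norm (X i - z) \<le> l + e"
      by (rule eventually_mono) simp
    then show "asymp_radius F X z \<le> l + e"
      by (rule asymp_radius_le[OF assms(1)])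
  qed
  show "l \<le> asymp_radius F X z"
  proof (rule field_le_epsilon)
    fix e :: real assume "0 < e"
    from eventually_le_asymp_radius_add[OF assms(2) this]
    show "l \<le> asymp_radius F X z + e"
      by (rule tendsto_upperbound[OF assms(3) _ assms(1)])
  qed
qed

lemma parallelogram_midpoint:
  fixes x u v :: "'a::real_inner"
  shows "(norm (x - (1/2) *\<^sub>R (u + v)))\<^sup>2
    = ((norm (x - u))\<^sup>2 + (norm (x - v))\<^sup>2) / 2 - (norm (u - v))\<^sup>2 / 4"
  by (simp add: power2_norm_eq_inner inner_diff inner_add inner_commute field_simps)

text \<open>The parallelogram law survives the passage to the limes superior as an inequality. It
  makes the squared radius uniformly convex, which gives both the existence and the uniqueness
  of minimisers.\<close>

lemma asymp_radius_midpoint: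
  fixes X :: "'i \<Rightarrow> 'a::real_inner"
  assumes "F \<noteq> bot" "Bfun X F"
  shows "(norm (u - v))\<^sup>2 \<le> 2 * (asymp_radius F X u)\<^sup>2 + 2 * (asymp_radius F X v)\<^sup>2
    - 4 * (asymp_radius F X ((1/2) *\<^sub>R (u + v)))\<^sup>2"
proof -
  let ?r = "asymp_radius F X" and ?m = "(1/2) *\<^sub>R (u + v)"
  let ?B = "\<lambda>e. ((?r u + e)\<^sup>2 + (?r v + e)\<^sup>2) / 2 - (norm (u - v))\<^sup>2 / 4"
  \<comment> \<open>Eventual bounds hold only up to a positive error, which is sent to 0 afterwards.\<close>
  have bound: "(?r ?m)\<^sup>2 \<le> ?B e" if "0 < e" for e
  proof -
    have "\<forall>\<^sub>F i in F. (norm (X i - ?m))\<^sup>2 \<le> ?B e"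
      using eventually_le_asymp_radius_add[OF assms(2) that, of u]
        eventually_le_asymp_radius_add[OF assms(2) that, of v]
    proof eventually_elim
      case (elim i)
      then have "(norm (X i - u))\<^sup>2 \<le> (?r u + e)\<^sup>2" "(norm (X i - v))\<^sup>2 \<le> (?r v + e)\<^sup>2"
        by (simp_all add: power_mono)
      then show ?case
        unfolding parallelogram_midpoint by simp
    qed
    then have "\<forall>\<^sub>F i in F. norm (X i - ?m) \<le> sqrt (?B e)"
      by (rule eventually_mono) (rule real_le_rsqrt)
    then have "?r ?m \<le> sqrt (?B e)" "0 \<le> sqrt (?B e)"
      by (rule asymp_radius_le[OF assms(1)], rule eventual_bound_nonneg[OF assms(1)])
    then show ?thesis
      using asymp_radius_nonneg[OF assms, of ?m] by (intro sqrt_ge_absD) simp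
  qed
  have "(?B \<longlongrightarrow> ?B 0) (at_right 0)"
    by (intro tendsto_intros) simp_all
  moreover have "\<forall>\<^sub>F e in at_right 0. (?r ?m)\<^sup>2 \<le> ?B e"
    using eventually_at_right_less by (rule eventually_mono) (rule bound)
  ultimately have "(?r ?m)\<^sup>2 \<le> ?B 0"
    by (rule tendsto_lowerbound) simp
  then show ?thesis
    by (simp add: field_simps)
qed

text \<open>The sublevel sets of the radius just above its infimum over \<open>K\<close> are closed, nested and, by
  uniform convexity, of diameter tending to 0; completeness gives a common point.\<close>

lemma asymp_radius_minimizer_ex:
  fixes X :: "'i \<Rightarrow> 'a::{real_inner, complete_space}"
  assumes "F \<noteq> bot" "Bfun X F" "closed K" "convex K" "K \<noteq> {}"
  obtains q where "q \<in> K" "\<And>z. z \<in> K \<Longrightarrow> asymp_radius F X q \<le> asymp_radius F X z"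
proof -
  let ?r = "asymp_radius F X"
  define m where "m = Inf (?r ` K)"
  define S where "S n = {z \<in> K. ?r z \<le> m + inverse (Suc n)}" for n
  have bdd: "bdd_below (?r ` K)"
    using asymp_radius_nonneg[OF assms(1,2)] by (intro bdd_belowI2)
  have m_le: "m \<le> ?r z" if "z \<in> K" for z
    unfolding m_def using bdd that by (intro cInf_lower) auto
  have m_nonneg: "0 \<le> m"
    unfolding m_def using assms(5) asymp_radius_nonneg[OF assms(1,2)] by (intro cINF_greatest)
  have close: "(dist z w)\<^sup>2 \<le> (8 * m + 4) * inverse (Suc n)" if "z \<in> S n" "w \<in> S n" for n z w
  proof -
    let ?e = "inverse (real (Suc n))"
    have zw: "z \<in> K" "w \<in> K" "?r z \<le> m + ?e" "?r w \<le> m + ?e"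
      using that by (auto simp: S_def)
    have "(1/2) *\<^sub>R (z + w) \<in> K"
      using convexD[OF assms(4) zw(1,2), of "1/2" "1/2"] by (simp add: scaleR_add_right)
    then have "m\<^sup>2 \<le> (?r ((1/2) *\<^sub>R (z + w)))\<^sup>2"
      using m_le m_nonneg by (intro power_mono)
    moreover have "(?r z)\<^sup>2 \<le> (m + ?e)\<^sup>2" "(?r w)\<^sup>2 \<le> (m + ?e)\<^sup>2"
      using zw asymp_radius_nonneg[OF assms(1,2)] by (simp_all add: power_mono)
    ultimately have "(norm (z - w))\<^sup>2 \<le> 4 * (m + ?e)\<^sup>2 - 4 * m\<^sup>2"
      using asymp_radius_midpoint[OF assms(1,2), of z w] by linarith
    also have "\<dots> = 8 * m * ?e + 4 * (?e * ?e)"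
      by (simp add: power2_eq_square algebra_simps)
    also have "\<dots> \<le> 8 * m * ?e + 4 * ?e"
    proof -
      have "?e * ?e \<le> ?e * 1"
        by (intro mult_left_mono) (auto simp: inverse_le_1_iff)
      then show ?thesis by simp
    qed
    finally show ?thesis
      by (simp add: dist_norm algebra_simps)
  qed
  have "\<exists>q. \<forall>n. q \<in> S n"
  proof (rule decreasing_closed_nest[of S])
    show "closed (S n)" for n
    proof -
      have "closed {z. ?r z \<le> m + inverse (Suc n)}"
        using continuous_on_asymp_radius[OF assms(1,2)]
        by (intro closed_Collect_le continuous_on_const)
      then have "closed (K \<inter> {z. ?r z \<le> m + inverse (Suc n)})"
        using assms(3) by (rule closed_Int[rotated])
      then show ?thesis
        by (simp add: S_def Collect_conj_eq)
    qed
    show "S n \<noteq> {}" for n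
    proof -
      have "Inf (?r ` K) < m + inverse (Suc n)"
        by (simp add: m_def)
      then have "\<exists>s\<in>?r ` K. s < m + inverse (Suc n)"
        using assms(5) by (intro cInf_lessD) simp_all
      then show ?thesis
        by (fastforce simp: S_def)
    qed
    show "S n \<subseteq> S k" if "k \<le> n" for k n
    proof -
      have "inverse (real (Suc n)) \<le> inverse (real (Suc k))"
        using that by (intro le_imp_inverse_le) auto
      then show ?thesis
        unfolding S_def by (intro Collect_mono) linarith
    qed
    show "\<exists>n. \<forall>z\<in>S n. \<forall>w\<in>S n. dist z w < e" if "0 < e" for e
    proof -
      have "0 < e\<^sup>2 / (8 * m + 4)"
        using that m_nonneg by simp
      then obtain n where "inverse (real (Suc n)) < e\<^sup>2 / (8 * m + 4)"
        using reals_Archimedean by blast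
      then have "(8 * m + 4) * inverse (real (Suc n)) < e\<^sup>2"
        using m_nonneg by (simp add: pos_less_divide_eq mult.commute)
      then have "(dist z w)\<^sup>2 < e\<^sup>2" if "z \<in> S n" "w \<in> S n" for z w
        using close[OF that] by linarith
      then show ?thesis
        using that by (meson less_imp_le power_less_imp_less_base)
    qed
    show "\<exists>q. \<forall>n. q \<in> S n" if "\<And>n. q \<in> S n" for q
      using that by blast
  qed
  then obtain q where q: "\<And>n. q \<in> S n"
    by blast
  have "?r q \<le> m"
  proof (rule LIMSEQ_le_const)
    show "(\<lambda>n. m + inverse (Suc n)) \<longlonglongrightarrow> m"
      using tendsto_add[OF tendsto_const LIMSEQ_inverse_real_of_nat, of m] by simp
    show "\<exists>N. \<forall>n\<ge>N. ?r q \<le> m + inverse (Suc n)"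
      using q by (auto simp: S_def)
  qed
  moreover have "q \<in> K"
    using q by (simp add: S_def)
  ultimately show ?thesis
    using that m_le order_trans by blast
qed

lemma asymp_center_ex:
  fixes X :: "'i \<Rightarrow> 'a::{real_inner, complete_space}"
  assumes "F \<noteq> bot" "Bfun X F"
  obtains q where "asymp_center F X q"
  using asymp_radius_minimizer_ex[OF assms closed_UNIV convex_UNIV]
  by (auto simp: asymp_center_def)

lemma asymp_center_unique:
  fixes X :: "'i \<Rightarrow> 'a::real_inner"
  assumes "F \<noteq> bot" "Bfun X F" "asymp_center F X q" "asymp_radius F X z \<le> asymp_radius F X q"
  shows "z = q"
proof -
  let ?r = "asymp_radius F X"
  have "(?r q)\<^sup>2 \<le> (?r ((1/2) *\<^sub>R (z + q)))\<^sup>2" "(?r z)\<^sup>2 \<le> (?r q)\<^sup>2"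
    using assms asymp_radius_nonneg[OF assms(1,2)]
    by (auto simp: asymp_center_def intro!: power_mono)
  then have "(norm (z - q))\<^sup>2 \<le> 0"
    using asymp_radius_midpoint[OF assms(1,2), of z q] by linarith
  then show ?thesis
    by simp
qed

text \<open>Nearest points are the minimisers of the asymptotic radius of a constant sequence,
  which settles their existence in Hilbert spaces of any dimension.\<close>

lemma nearest_point_ex:
  fixes a :: "'a::{real_inner, complete_space}"
  assumes "closed K" "convex K" "K \<noteq> {}"
  obtains p where "p \<in> K" "\<And>z. z \<in> K \<Longrightarrow> dist a p \<le> dist a z"
proof -
  have "Bfun (\<lambda>_. a) sequentially"
    by (rule BfunI[of _ "norm a"]) simp
  moreover from this have "asymp_radius sequentially (\<lambda>_. a) z = dist a z" for z
    by (intro asymp_radius_eq_limit) (auto simp: dist_norm)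
  ultimately show ?thesis
    using asymp_radius_minimizer_ex[OF _ _ assms, of sequentially "\<lambda>_. a"] that by auto
qed

text \<open>Projecting the centre onto \<open>K\<close> brings it closer to all points of \<open>K\<close>, so the projection has
  at most the same asymptotic radius; uniqueness leaves only the centre itself.\<close>

lemma asymp_center_in_closed_convex:
  fixes X :: "'i \<Rightarrow> 'a::{real_inner, complete_space}"
  assumes "F \<noteq> bot" "Bfun X F" "asymp_center F X q"
    and "closed K" "convex K" "\<forall>\<^sub>F i in F. X i \<in> K"
  shows "q \<in> K"
proof -
  have "K \<noteq> {}"
    using eventually_happens'[OF assms(1,6)] by blast
  then obtain p where p: "p \<in> K" "\<And>z. z \<in> K \<Longrightarrow> dist q p \<le> dist q z"
    using nearest_point_ex[OF assms(4,5)] by blast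
  have closer: "norm (x - p) \<le> norm (x - q)" if "x \<in> K" for x
  proof -
    have "inner (q - p) (x - p) \<le> 0"
      using any_closest_point_dot[OF assms(5,4) p(1) that] p(2) by blast
    moreover have "(norm (x - q))\<^sup>2
        = (norm (x - p))\<^sup>2 + (norm (q - p))\<^sup>2 - 2 * inner (q - p) (x - p)"
      by (simp add: power2_norm_eq_inner inner_diff inner_commute algebra_simps)
    ultimately have "(norm (x - p))\<^sup>2 \<le> (norm (x - q))\<^sup>2"
      using zero_le_power2[of "norm (q - p)"] by linarith
    then show ?thesis
      by (rule power2_le_imp_le) simp
  qed
  have "asymp_radius F X p \<le> asymp_radius F X q + 0"
  proof (rule asymp_radius_le_add[OF assms(1,2)])
    fix e :: real assume "0 < e"
    show "\<forall>\<^sub>F i in F. norm (X i - p) \<le> norm (X i - q) + 0 + e"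
      using assms(6) by (rule eventually_mono) (use closer \<open>0 < e\<close> in fastforce)
  qed
  then have "p = q"
    using asymp_center_unique[OF assms(1-3)] by simp
  with p(1) show ?thesis
    by simp
qed

section \<open>Weak convergence through asymptotic centres\<close>

lemma Bfun_subfilter: "Bfun X F \<Longrightarrow> G \<le> F \<Longrightarrow> Bfun X G"
  by (auto simp: Bfun_metric_def intro: filter_leD)

text \<open>If \<open>f (X i) \<ge> c\<close> happened frequently, then on the finer filter that records just these
  indices the family would lie in the closed half-space where \<open>f \<ge> c\<close>. The centre along that
  filter is again \<open>q\<close>, so it would lie in the half-space as well.\<close>

lemma functional_eventually_less:
  fixes X :: "'i \<Rightarrow> 'a::{real_inner, complete_space}" and f :: "'a \<Rightarrow> real"
  assumes "Bfun X F" "bounded_linear f" "f q < c"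
    and center: "\<And>G. G \<le> F \<Longrightarrow> G \<noteq> bot \<Longrightarrow> asymp_center G X q"
  shows "\<forall>\<^sub>F i in F. f (X i) < c"
proof (rule ccontr)
  let ?H = "{z. c \<le> f z}" and ?G = "inf F (principal {i. c \<le> f (X i)})"
  assume "\<not> (\<forall>\<^sub>F i in F. f (X i) < c)"
  then have G: "?G \<noteq> bot" "?G \<le> F"
    by (simp_all add: trivial_limit_def eventually_inf_principal not_le)
  have "closed ?H"
    using assms(2) by (intro closed_Collect_le continuous_on_const linear_continuous_on)
  moreover have "convex ?H"
  proof -
    have "?H = f -` {c..}"
      by auto
    then show ?thesis
      using convex_linear_vimage[OF bounded_linear.linear[OF assms(2)], of "{c..}"] by simp
  qed
  moreover have "\<forall>\<^sub>F i in ?G. X i \<in> ?H"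
    by (simp add: eventually_inf_principal)
  ultimately have "q \<in> ?H"
    by (rule asymp_center_in_closed_convex[OF G(1) Bfun_subfilter[OF assms(1) G(2)] center[OF G(2,1)]])
  with assms(3) show False
    by simp
qed

lemma functional_tendsto_if_center:
  fixes X :: "'i \<Rightarrow> 'a::{real_inner, complete_space}" and f :: "'a \<Rightarrow> real"
  assumes "Bfun X F" "bounded_linear f"
    and center: "\<And>G. G \<le> F \<Longrightarrow> G \<noteq> bot \<Longrightarrow> asymp_center G X q"
  shows "((\<lambda>i. f (X i)) \<longlongrightarrow> f q) F"
proof (rule order_tendstoI)
  show "\<forall>\<^sub>F i in F. f (X i) < c" if "f q < c" for c
    using assms(1,2) that center by (rule functional_eventually_less)
  show "\<forall>\<^sub>F i in F. c < f (X i)" if "c < f q" for c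
  proof -
    have "\<forall>\<^sub>F i in F. - f (X i) < - c"
      using assms(1) bounded_linear_minus[OF assms(2)] _ center
      by (rule functional_eventually_less) (use that in simp)
    then show ?thesis
      by simp
  qed
qed

text \<open>Opial's lemma with asymptotic centres in the role of weak cluster points. For points of
  \<open>A\<close> the distances converge, so their asymptotic radius is the same along every finer filter.
  As all centres belong to \<open>A\<close>, they minimise the same function on \<open>A\<close> and hence coincide.\<close>

lemma opial_asymp_center:
  fixes X :: "'i \<Rightarrow> 'a::{real_inner, complete_space}"
  assumes "F \<noteq> bot" "Bfun X F"
    and conv: "\<And>z. z \<in> A \<Longrightarrow> \<exists>l. ((\<lambda>i. norm (X i - z)) \<longlongrightarrow> l) F"
    and center: "\<And>G q. G \<le> F \<Longrightarrow> G \<noteq> bot \<Longrightarrow> asymp_center G X q \<Longrightarrow> q \<in> A"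
  obtains q where "q \<in> A"
    "\<And>f :: 'a \<Rightarrow> real. bounded_linear f \<Longrightarrow> ((\<lambda>i. f (X i)) \<longlongrightarrow> f q) F"
proof -
  obtain q where q: "asymp_center F X q"
    using asymp_center_ex[OF assms(1,2)] .
  have "q \<in> A"
    using center[OF order_refl assms(1) q] .
  have "asymp_center G X q" if G: "G \<le> F" "G \<noteq> bot" for G
  proof -
    have bG: "Bfun X G"
      using Bfun_subfilter[OF assms(2) G(1)] .
    have same: "asymp_radius G X z = asymp_radius F X z" if z: "z \<in> A" for z
    proof -
      obtain l where l: "((\<lambda>i. norm (X i - z)) \<longlongrightarrow> l) F"
        using conv[OF z] by blast
      then show ?thesis
        using asymp_radius_eq_limit[OF assms(1,2) l]
          asymp_radius_eq_limit[OF G(2) bG tendsto_mono[OF G(1) l]] by simp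
    qed
    obtain q' where q': "asymp_center G X q'"
      using asymp_center_ex[OF G(2) bG] .
    have "q' \<in> A"
      using center[OF G q'] .
    then have "asymp_radius G X q \<le> asymp_radius G X q'"
      using q \<open>q \<in> A\<close> by (simp add: same asymp_center_def)
    then have "q = q'"
      using asymp_center_unique[OF G(2) bG q'] by simp
    with q' show ?thesis
      by simp
  qed
  then show ?thesis
    by (intro that[OF \<open>q \<in> A\<close>] functional_tendsto_if_center[OF assms(2)])
qed

section \<open>The Krasnoselskii iteration of a nonexpansive map\<close>

lemma norm_sq_convex_combination:
  fixes a b :: "'a::real_inner"
  shows "(norm ((1 - t) *\<^sub>R a + t *\<^sub>R b))\<^sup>2
    = (1 - t) * (norm a)\<^sup>2 + t * (norm b)\<^sup>2 - t * (1 - t) * (norm (a - b))\<^sup>2"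
  by (simp add: power2_norm_eq_inner inner_diff inner_add inner_commute algebra_simps)

text \<open>The identity for \<open>\<parallel>(1 - t) a + t b\<parallel>\<^sup>2\<close> shows that each step decreases the squared distance
  to a fixed point by at least \<open>t (1 - t) \<parallel>x\<^sub>n - S x\<^sub>n\<parallel>\<^sup>2\<close>. This one estimate yields the convergence
  of the distances to fixed points as well as \<open>x\<^sub>n - S x\<^sub>n \<rightarrow> 0\<close>, the two inputs of Opial's
  lemma.\<close>

lemma krasnoselskii_weak_convergence:
  fixes S :: "'a \<Rightarrow> 'a::{real_inner, complete_space}"
  assumes "closed C" "convex C" "S ` C \<subseteq> C"
    and nonexp: "\<And>u v. u \<in> C \<Longrightarrow> v \<in> C \<Longrightarrow> norm (S u - S v) \<le> norm (u - v)"
    and "p \<in> C" "S p = p"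
    and t: "0 < t" "t < 1"
    and "x 0 \<in> C" and step: "\<And>n. x (Suc n) = (1 - t) *\<^sub>R x n + t *\<^sub>R S (x n)"
  obtains q where "q \<in> C" "S q = q" "weakly_converges x q"
proof -
  have x_C: "x n \<in> C" for n
  proof (induction n)
    case (Suc n)
    then show ?case
      using convexD_alt[OF assms(2), of "x n" "S (x n)" t] assms(3) t step by force
  qed (rule assms)
  have fejer: "(norm (x (Suc n) - z))\<^sup>2
      \<le> (norm (x n - z))\<^sup>2 - t * (1 - t) * (norm (x n - S (x n)))\<^sup>2"
    if "z \<in> C" "S z = z" for z n
  proof -
    have "x (Suc n) - z = (1 - t) *\<^sub>R (x n - z) + t *\<^sub>R (S (x n) - z)"
      by (simp add: step algebra_simps)
    then have "(norm (x (Suc n) - z))\<^sup>2 = (1 - t) * (norm (x n - z))\<^sup>2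
        + t * (norm (S (x n) - z))\<^sup>2 - t * (1 - t) * (norm (x n - S (x n)))\<^sup>2"
      by (simp add: norm_sq_convex_combination)
    moreover have "(norm (S (x n) - z))\<^sup>2 \<le> (norm (x n - z))\<^sup>2"
      using nonexp[OF x_C that(1), of n] that(2) by (simp add: power_mono)
    then have "t * (norm (S (x n) - z))\<^sup>2 \<le> t * (norm (x n - z))\<^sup>2"
      using t by simp
    ultimately show ?thesis
      by (simp add: algebra_simps)
  qed
  have decreasing: "norm (x (Suc n) - z) \<le> norm (x n - z)" if "z \<in> C" "S z = z" for z n
  proof (rule power2_le_imp_le)
    have "0 \<le> t * (1 - t) * (norm (x n - S (x n)))\<^sup>2"
      using t by simp
    then show "(norm (x (Suc n) - z))\<^sup>2 \<le> (norm (x n - z))\<^sup>2"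
      using fejer[OF that, of n] by linarith
  qed simp
  then have decseq: "decseq (\<lambda>n. norm (x n - z))" if "z \<in> C" "S z = z" for z
    using that by (intro decseq_SucI)
  have conv: "\<exists>l. (\<lambda>n. norm (x n - z)) \<longlonglongrightarrow> l" if z: "z \<in> C" "S z = z" for z
  proof -
    obtain l where "(\<lambda>n. norm (x n - z)) \<longlonglongrightarrow> l"
      by (rule decseq_convergent[OF decseq[OF z], of 0]) auto
    then show ?thesis ..
  qed
  obtain l where l: "(\<lambda>n. norm (x n - p)) \<longlonglongrightarrow> l"
    using conv assms(5,6) by blast
  have bounded: "Bfun x sequentially"
  proof -
    have "norm (x n) \<le> norm (x 0 - p) + norm p" for n
      using decseqD[OF decseq[OF assms(5,6)], of 0 n] norm_triangle_sub[of "x n" p] by simp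
    then show ?thesis
      by (intro BfunI always_eventually) blast
  qed
  have regular: "(\<lambda>n. norm (x n - S (x n))) \<longlonglongrightarrow> 0"
  proof -
    let ?d = "\<lambda>n. (norm (x n - p))\<^sup>2 - (norm (x (Suc n) - p))\<^sup>2"
    have "?d \<longlonglongrightarrow> l\<^sup>2 - l\<^sup>2"
      by (intro tendsto_diff tendsto_power l LIMSEQ_Suc[OF l])
    then have "(\<lambda>n. ?d n / (t * (1 - t))) \<longlonglongrightarrow> 0"
      by (intro tendsto_divide_zero) simp
    moreover have "\<forall>\<^sub>F n in sequentially.
        norm ((norm (x n - S (x n)))\<^sup>2) \<le> ?d n / (t * (1 - t))"
      using fejer[OF assms(5,6)] t
      by (intro always_eventually allI) (simp add: pos_le_divide_eq mult.commute algebra_simps)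
    ultimately have "(\<lambda>n. (norm (x n - S (x n)))\<^sup>2) \<longlonglongrightarrow> 0"
      by (rule Lim_null_comparison[rotated])
    then show ?thesis
      by simp
  qed
  \<comment> \<open>Along a finer filter, \<open>S q\<close> is asymptotically at most as far from the iterates as their
    centre \<open>q\<close>, so it is that centre.\<close>
  have demiclosed: "q \<in> {z \<in> C. S z = z}"
    if G: "G \<le> sequentially" "G \<noteq> bot" and q: "asymp_center G x q" for G q
  proof -
    have bG: "Bfun x G"
      using Bfun_subfilter[OF bounded G(1)] .
    have "q \<in> C"
      using asymp_center_in_closed_convex[OF G(2) bG q assms(1,2)] x_C by simp
    have "asymp_radius G x (S q) \<le> asymp_radius G x q + 0"
    proof (rule asymp_radius_le_add[OF G(2) bG])
      fix e :: real assume "0 < e"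
      then have "\<forall>\<^sub>F n in G. norm (x n - S (x n)) < e"
        using order_tendstoD(2)[OF tendsto_mono[OF G(1) regular]] by simp
      then show "\<forall>\<^sub>F n in G. norm (x n - S q) \<le> norm (x n - q) + 0 + e"
      proof eventually_elim
        case (elim n)
        have "norm (x n - S q) \<le> norm (x n - S (x n)) + norm (S (x n) - S q)"
          using norm_triangle_ineq[of "x n - S (x n)" "S (x n) - S q"] by simp
        with elim nonexp[OF x_C[of n] \<open>q \<in> C\<close>] show ?case
          by simp
      qed
    qed
    then have "S q = q"
      using asymp_center_unique[OF G(2) bG q] by simp
    with \<open>q \<in> C\<close> show ?thesis
      by simp
  qed
  show ?thesis
  proof (rule opial_asymp_center[OF sequentially_bot bounded _ demiclosed])
    show "\<exists>l. (\<lambda>n. norm (x n - z)) \<longlonglongrightarrow> l" if "z \<in> {z \<in> C. S z = z}" for z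
      using conv that by simp
  next
    fix q assume "q \<in> {z \<in> C. S z = z}"
      and "\<And>f :: 'a \<Rightarrow> real. bounded_linear f \<Longrightarrow> (\<lambda>n. f (x n)) \<longlonglongrightarrow> f q"
    then show ?thesis
      by (intro that[of q]) (simp_all add: weakly_converges_def)
  qed
qed

section \<open>Best approximations of enriched nonexpansive multivalued maps\<close>

lemma best_approx_iff:
  assumes "u \<in> T x"
  shows "u \<in> best_approx T x \<longleftrightarrow> (\<forall>z\<in>T x. dist x u \<le> dist x z)"
proof
  show "u \<in> best_approx T x \<Longrightarrow> \<forall>z\<in>T x. dist x u \<le> dist x z"
    using infdist_le by (fastforce simp: best_approx_def)
  assume "\<forall>z\<in>T x. dist x u \<le> dist x z"
  then have "dist x u \<le> infdist x (T x)"
    using assms by (subst infdist_notempty) (auto intro: cINF_greatest)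
  then show "u \<in> best_approx T x"
    using assms infdist_le[OF assms, of x] by (auto simp: best_approx_def)
qed

lemma best_approx_singleton:
  fixes T :: "'a \<Rightarrow> 'a::{real_inner, complete_space} set"
  assumes "T x \<in> CC C"
  shows "\<exists>!u. u \<in> best_approx T x"
proof -
  have T: "closed (T x)" "convex (T x)" "T x \<noteq> {}"
    using assms by (auto simp: CC_def)
  obtain u where u: "u \<in> T x" "\<And>z. z \<in> T x \<Longrightarrow> dist x u \<le> dist x z"
    using nearest_point_ex[OF T] by blast
  have "u \<in> best_approx T x"
    using u by (simp add: best_approx_iff)
  moreover have "v = u" if "v \<in> best_approx T x" for v
  proof -
    have "v \<in> T x"
      using that by (simp add: best_approx_def)
    then show ?thesis
      using any_closest_point_unique[OF T(2,1) _ u(1)] u(2) that by (simp add: best_approx_iff)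
  qed
  ultimately show ?thesis
    by blast
qed

definition best_map :: "('a::real_normed_vector \<Rightarrow> 'a set) \<Rightarrow> 'a \<Rightarrow> 'a" where
  "best_map T x = (THE u. u \<in> best_approx T x)"

lemma best_map_in_best_approx:
  fixes T :: "'a \<Rightarrow> 'a::{real_inner, complete_space} set"
  assumes "T x \<in> CC C"
  shows "best_map T x \<in> best_approx T x"
  unfolding best_map_def by (rule theI'[OF best_approx_singleton[of T x C, OF assms]])

lemma best_map_eqI:
  fixes T :: "'a \<Rightarrow> 'a::{real_inner, complete_space} set"
  assumes "T x \<in> CC C" "u \<in> best_approx T x"
  shows "best_map T x = u"
  unfolding best_map_def
  using best_approx_singleton[of T x C, OF assms(1)] assms(2) by (rule the1_equality)

lemma best_map_eq_self_iff:
  fixes T :: "'a \<Rightarrow> 'a::{real_inner, complete_space} set"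
  assumes "T x \<in> CC C"
  shows "best_map T x = x \<longleftrightarrow> x \<in> T x"
proof
  show "best_map T x = x \<Longrightarrow> x \<in> T x"
    using best_map_in_best_approx[of T x C] assms by (simp add: best_approx_def)
  show "x \<in> T x \<Longrightarrow> best_map T x = x"
    by (intro best_map_eqI[of T x C] assms) (simp add: best_approx_def)
qed

text \<open>This is \<open>(b x + best_map T x) / (b + 1)\<close>, written as a convex combination so that it
  visibly stays in a convex set.\<close>

definition averaged_best_map ::
    "real \<Rightarrow> ('a::real_normed_vector \<Rightarrow> 'a set) \<Rightarrow> 'a \<Rightarrow> 'a" where
  "averaged_best_map b T x = (1 - 1 / (b + 1)) *\<^sub>R x + (1 / (b + 1)) *\<^sub>R best_map T x"

lemma averaged_best_map_eq_self_iff: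
  fixes T :: "'a \<Rightarrow> 'a::{real_inner, complete_space} set"
  assumes "0 \<le> b" "T x \<in> CC C"
  shows "averaged_best_map b T x = x \<longleftrightarrow> x \<in> T x"
proof -
  have "averaged_best_map b T x = x \<longleftrightarrow> (1 / (b + 1)) *\<^sub>R (best_map T x - x) = 0"
    by (simp add: averaged_best_map_def algebra_simps)
  also have "\<dots> \<longleftrightarrow> best_map T x = x"
    using assms(1) by simp
  finally show ?thesis
    using best_map_eq_self_iff[of T x C] assms(2) by simp
qed

lemma averaged_best_map_in:
  fixes T :: "'a \<Rightarrow> 'a::{real_inner, complete_space} set"
  assumes "0 \<le> b" "convex C" "x \<in> C" "T x \<in> CC C"
  shows "averaged_best_map b T x \<in> C"
proof -
  have "best_map T x \<in> C"
    using best_map_in_best_approx[of T x C] assms(4) by (auto simp: best_approx_def CC_def)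
  then show ?thesis
    unfolding averaged_best_map_def using assms(1-3) by (intro convexD_alt) auto
qed

text \<open>Dividing the enriched nonexpansiveness inequality by \<open>b + 1\<close> leaves exactly this
  estimate, because the nearest point which the inequality provides in \<open>T y\<close> can only be
  \<open>best_map T y\<close>.\<close>

lemma averaged_best_map_nonexpansive:
  fixes T :: "'a \<Rightarrow> 'a::{real_inner, complete_space} set"
  assumes "star_enriched_nonexpansive b C T" "\<forall>x\<in>C. T x \<in> CC C" "x \<in> C" "y \<in> C"
  shows "norm (averaged_best_map b T x - averaged_best_map b T y) \<le> norm (x - y)"
proof -
  let ?g = "best_map T"
  have b: "0 \<le> b"
    using assms(1) by (simp add: star_enriched_nonexpansive_def)
  have "?g x \<in> T x" "dist x (?g x) = infdist x (T x)"
    using best_map_in_best_approx[of T x C] assms(2,3) by (auto simp: best_approx_def)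
  then obtain v where v: "v \<in> T y" "dist y v = infdist y (T y)"
    "norm (b *\<^sub>R (x - y) + (?g x - v)) \<le> (b + 1) * norm (x - y)"
    using assms(1,3,4) unfolding star_enriched_nonexpansive_def by blast
  have "?g y = v"
    using best_map_eqI[of T y C] v(1,2) assms(2,4) by (simp add: best_approx_def)
  have scaled: "(b + 1) *\<^sub>R averaged_best_map b T z = b *\<^sub>R z + ?g z" for z
  proof -
    have "(b + 1) * (1 - 1 / (b + 1)) = b" "(b + 1) * (1 / (b + 1)) = 1"
      using b by (simp_all add: field_simps)
    then show ?thesis
      by (simp only: averaged_best_map_def scaleR_add_right scaleR_scaleR scaleR_one)
  qed
  have "(b + 1) * norm (averaged_best_map b T x - averaged_best_map b T y)
      = norm ((b + 1) *\<^sub>R averaged_best_map b T x - (b + 1) *\<^sub>R averaged_best_map b T y)"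
    using b by (simp flip: scaleR_diff_right)
  also have "\<dots> = norm (b *\<^sub>R (x - y) + (?g x - v))"
    unfolding scaled \<open>?g y = v\<close> by (simp add: algebra_simps)
  also have "\<dots> \<le> (b + 1) * norm (x - y)"
    by (rule v(3))
  finally show ?thesis
    using b by simp
qed

theorem theorem8:
  fixes C :: "'a::{real_inner, complete_space} set"
    and T :: "'a \<Rightarrow> 'a set"
    and b :: real
  assumes "C \<noteq> {}" and "closed C" and "convex C"
    and "\<forall>x\<in>C. T x \<in> CC C"
    and "star_enriched_nonexpansive b C T"
    and "\<exists>p\<in>fixed_points C T. T p = {p}"
  shows "\<exists>\<theta>::real. 0 < \<theta> \<and> \<theta> < 1 \<and>
    (\<forall>x0\<in>C. \<forall>x y :: nat \<Rightarrow> 'a.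
       x 0 = x0 \<longrightarrow>
       (\<forall>n. y n \<in> best_approx T (x n) \<and> x (Suc n) = (1 - \<theta>) *\<^sub>R x n + \<theta> *\<^sub>R y n) \<longrightarrow>
       (\<exists>q\<in>fixed_points C T. weakly_converges x q))"
proof -
  let ?S = "averaged_best_map b T"
  have b: "0 \<le> b"
    using assms(5) by (simp add: star_enriched_nonexpansive_def)
  have T_CC: "T z \<in> CC C" if "z \<in> C" for z
    using assms(4) that by blast
  have S_C: "?S z \<in> C" if "z \<in> C" for z
    using averaged_best_map_in[of b C z T] b assms(3) that T_CC by blast
  have S_fix: "?S z = z \<longleftrightarrow> z \<in> T z" if "z \<in> C" for z
    using b T_CC[OF that] by (rule averaged_best_map_eq_self_iff)
  obtain p where p: "p \<in> C" "p \<in> T p"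
    using assms(6) by (auto simp: fixed_points_def)
  \<comment> \<open>A step of length \<open>\<theta>\<close> towards the nearest point is a step of length \<open>\<theta> (b + 1)\<close> towards
    its average with the current point; every \<open>\<theta>\<close> for which this product lies strictly between 0 and 1 would do.\<close>
  define \<theta> where "\<theta> = 1 / (2 * (b + 1))"
  have \<theta>: "0 < \<theta>" "\<theta> < 1"
    using b by (auto simp: \<theta>_def field_simps)
  have half_step: "(1 - \<theta>) *\<^sub>R z + \<theta> *\<^sub>R best_map T z = (1 - 1/2) *\<^sub>R z + (1/2) *\<^sub>R ?S z" for z
  proof -
    have "1 / (b + 1) = 2 * \<theta>"
      using b by (simp add: \<theta>_def field_simps)
    then have S: "?S z = (1 - 2 * \<theta>) *\<^sub>R z + (2 * \<theta>) *\<^sub>R best_map T z"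
      by (simp add: averaged_best_map_def)
    have "(1 - 1/2) *\<^sub>R z + (1/2) *\<^sub>R ?S z
        = ((1 - 1/2) + (1/2) * (1 - 2 * \<theta>)) *\<^sub>R z + ((1/2) * (2 * \<theta>)) *\<^sub>R best_map T z"
      by (simp only: S scaleR_add_right scaleR_add_left scaleR_scaleR add.assoc)
    also have "(1 - 1/2) + (1/2) * (1 - 2 * \<theta>) = 1 - \<theta>"
      by (simp add: field_simps)
    finally show ?thesis
      by simp
  qed
  have "\<exists>q\<in>fixed_points C T. weakly_converges x q"
    if x0: "x 0 \<in> C"
      and y: "\<And>n. y n \<in> best_approx T (x n)"
      and iter: "\<And>n. x (Suc n) = (1 - \<theta>) *\<^sub>R x n + \<theta> *\<^sub>R y n" for x y
  proof -
    have step: "x (Suc n) = (1 - 1/2) *\<^sub>R x n + (1/2) *\<^sub>R ?S (x n)" if "x n \<in> C" for n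
      unfolding iter best_map_eqI[OF T_CC[OF that] y, symmetric] by (rule half_step)
    have x_C: "x n \<in> C" for n
    proof (induction n)
      case (Suc n)
      then show ?case
        unfolding step[OF Suc] by (intro convexD_alt[OF assms(3)] S_C) simp_all
    qed (rule x0)
    have "?S ` C \<subseteq> C"
      using S_C by blast
    moreover have "?S p = p"
      using S_fix p by blast
    ultimately obtain q where "q \<in> C" "?S q = q" "weakly_converges x q"
      using krasnoselskii_weak_convergence[OF assms(2,3) _
          averaged_best_map_nonexpansive[OF assms(5,4)] p(1), where t = "1/2" and x = x]
        x0 step[OF x_C] by auto
    then show ?thesis
      using S_fix by (auto simp: fixed_points_def)
  qed
  with \<theta> show ?thesis
    by blast
qed

end
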